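(* Let $n\ge2$, let $f:M^n\to\mathbb S^{n+1}$ be a smooth, closed, oriented, embedded hypersurface, and let $E_k$ denote the normalised $k$-th mean curvature of $M$. Let $b_i$ be the focal maps associated with the principal curvatures $\lambda_1\ge\dots\ge\lambda_n$. Then $$\frac{n(n+1)}{(2n(n-1))^{\frac{n+1}2}}\bigl|V[b_n]-V[b_1]\bigr|\le\int_M(E_1^2-E_2)^{\frac{n+1}2}\,d\mu.$$
   Context: $\nu$ is the chosen unit normal along $f$, $\Omega$ is the domain enclosed by $M$ whose outward unit normal is $\nu$, and $d\mu$ is the induced measure. The second fundamental form is $A(X,Y)=\langle\overline\nabla_X\nu,Y\rangle$, with eigenvalues $\lambda_1\ge\dots\ge\lambda_n$ at each point (no sign assumption). $E_k=\sigma_k(\lambda_1,\dots,\lambda_n)/\binom nk$, with $\sigma_k$ the $k$-th elementary symmetric polynomial. The focal maps are $b_i(x)=\exp_{f(x)}\bigl(-\cot^{-1}(\lambda_i(x))\,\nu(x)\bigr)$ with $\cot^{-1}:\mathbb R\to(0,\pi)$. For continuous $u:M\to\mathbb R$, the oriented volume of the normal graph $\mathrm f(x)=\exp_{f(x)}(u(x)\nu(x))$ is $$V[\mathrm f]:=|\Omega|+\int_M\int_0^{u(x)}J(x,t)\,dt\,d\mu(x),\qquad J(x,t)=\prod_{j=1}^n(\cos t+\lambda_j(x)\sin t),$$ where $J$ is the signed Jacobian of $(x,t)\mapsto\exp_{f(x)}(t\nu(x))$ with respect to $dt\,d\mu$. $V[b_i]$ corresponds to $u=-\cot^{-1}\lambda_i$.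 *)

theory Defs
  imports "HOL-Analysis.Analysis"
begin

primrec Ck_on :: "nat \<Rightarrow> 'a::real_normed_vector set \<Rightarrow> ('a \<Rightarrow> 'b::real_normed_vector) \<Rightarrow> bool" where
  "Ck_on 0 V g \<longleftrightarrow> continuous_on V g"
| "Ck_on (Suc k) V g \<longleftrightarrow>
     g differentiable_on V \<and> (\<forall>v. Ck_on k V (\<lambda>y. frechet_derivative g (at y) v))"

text \<open>Only meant for open \<open>V\<close>, since the derivatives are unrestricted ones.\<close>

definition smooth_on :: "'a::real_normed_vector set \<Rightarrow> ('a \<Rightarrow> 'b::real_normed_vector) \<Rightarrow> bool" where
  "smooth_on V g \<longleftrightarrow> (\<forall>k. Ck_on k V g)"


text \<open>
  An atlas is a set of local parametrizations \<open>(V, p)\<close>, i.e. inverses of charts: \<open>p\<close> maps the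
  open set \<open>V\<close> of \<open>\<real>\<^sup>n\<close> homeomorphically onto an open subset of \<open>M\<close>. The manifold is closed,
  that is, compact without boundary; it need not be connected. Second countability is automatic.
\<close>

definition smooth_closed_manifold ::
    "'m::t2_space set \<Rightarrow> ((real ^ 'n) set \<times> (real ^ 'n \<Rightarrow> 'm)) set \<Rightarrow> bool" where
  "smooth_closed_manifold M A \<longleftrightarrow>
     compact M \<and>
     (\<forall>(V, p) \<in> A. open V \<and> openin (top_of_set M) (p ` V) \<and>
        (\<exists>c. homeomorphism V (p ` V) p c)) \<and>
     (\<Union>(V, p) \<in> A. p ` V) = M \<and>
     (\<forall>(V, p) \<in> A. \<forall>(W, q) \<in> A. smooth_on (V \<inter> p -` (q ` W)) (inv_into W q \<circ> p))"

definition smooth_map ::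
    "((real ^ 'n) set \<times> (real ^ 'n \<Rightarrow> 'm)) set \<Rightarrow> ('m \<Rightarrow> 'a::real_normed_vector) \<Rightarrow> bool" where
  "smooth_map A g \<longleftrightarrow> (\<forall>(V, p) \<in> A. smooth_on V (g \<circ> p))"

abbreviation pderiv_at ::
    "('m \<Rightarrow> 'a::real_normed_vector) \<Rightarrow> (real ^ 'n \<Rightarrow> 'm) \<Rightarrow> real ^ 'n \<Rightarrow> real ^ 'n \<Rightarrow> 'a" where
  "pderiv_at g p y \<equiv> frechet_derivative (g \<circ> p) (at y)"

definition smooth_embedding ::
    "'m::t2_space set \<Rightarrow> ((real ^ 'n) set \<times> (real ^ 'n \<Rightarrow> 'm)) set
      \<Rightarrow> ('m \<Rightarrow> 'a::euclidean_space) \<Rightarrow> bool" where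
  "smooth_embedding M A f \<longleftrightarrow>
     smooth_map A f \<and>
     (\<forall>(V, p) \<in> A. \<forall>y \<in> V. inj (pderiv_at f p y)) \<and>
     (\<exists>g. homeomorphism M (f ` M) f g)"


text \<open>The unit sphere, with \<open>T\<^sub>x\<close> identified with the orthogonal complement of \<open>x\<close>.\<close>

definition sphere_exp :: "'a::euclidean_space \<Rightarrow> 'a \<Rightarrow> 'a" where
  "sphere_exp x w = cos (norm w) *\<^sub>R x + (sin (norm w) / norm w) *\<^sub>R w"

definition tangential :: "'a::euclidean_space \<Rightarrow> 'a \<Rightarrow> 'a" where
  "tangential x w = w - (w \<bullet> x) *\<^sub>R x"

text \<open>The surface measure of the unit sphere: dimension of the ambient space times the Lebesgue
  measure of the cone over the set (polar coordinates).\<close>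

definition sphere_volume :: "'a::euclidean_space set \<Rightarrow> real" where
  "sphere_volume S = real DIM('a) * measure lborel {r *\<^sub>R x | r x. 0 < r \<and> r \<le> 1 \<and> x \<in> S}"


definition unit_normal_field ::
    "'m::t2_space set \<Rightarrow> ((real ^ 'n) set \<times> (real ^ 'n \<Rightarrow> 'm)) set
      \<Rightarrow> ('m \<Rightarrow> 'a::euclidean_space) \<Rightarrow> ('m \<Rightarrow> 'a) \<Rightarrow> bool" where
  "unit_normal_field M A f \<nu> \<longleftrightarrow>
     smooth_map A \<nu> \<and>
     (\<forall>x \<in> M. norm (\<nu> x) = 1 \<and> \<nu> x \<bullet> f x = 0) \<and>
     (\<forall>(V, p) \<in> A. \<forall>y \<in> V. \<forall>v. \<nu> (p y) \<bullet> pderiv_at f p y v = 0)"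

definition enclosed_domain ::
    "'m set \<Rightarrow> ('m \<Rightarrow> 'a::euclidean_space) \<Rightarrow> ('m \<Rightarrow> 'a) \<Rightarrow> 'a set \<Rightarrow> bool" where
  "enclosed_domain M f \<nu> \<Omega> \<longleftrightarrow>
     openin (top_of_set (sphere 0 1)) \<Omega> \<and> connected \<Omega> \<and>
     top_of_set (sphere 0 1) frontier_of \<Omega> = f ` M \<and>
     (\<forall>x \<in> M. \<exists>\<epsilon>>0. \<forall>t \<in> {0<..<\<epsilon>}.
        sphere_exp (f x) (- t *\<^sub>R \<nu> x) \<in> \<Omega> \<and> sphere_exp (f x) (t *\<^sub>R \<nu> x) \<notin> \<Omega>)"


text \<open>Induced metric and second fundamental form at \<open>p y\<close>, as bilinear forms in the coordinates
  given by \<open>p\<close>. The covariant derivative of the sphere along \<open>f\<close> is the tangential part of the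
  derivative in the ambient space.\<close>

definition induced_metric ::
    "('m \<Rightarrow> 'a::euclidean_space) \<Rightarrow> (real ^ 'n \<Rightarrow> 'm) \<Rightarrow> real ^ 'n
      \<Rightarrow> real ^ 'n \<Rightarrow> real ^ 'n \<Rightarrow> real" where
  "induced_metric f p y v w = pderiv_at f p y v \<bullet> pderiv_at f p y w"

definition second_fundamental_form ::
    "('m \<Rightarrow> 'a::euclidean_space) \<Rightarrow> ('m \<Rightarrow> 'a) \<Rightarrow> (real ^ 'n \<Rightarrow> 'm) \<Rightarrow> real ^ 'n
      \<Rightarrow> real ^ 'n \<Rightarrow> real ^ 'n \<Rightarrow> real" where
  "second_fundamental_form f \<nu> p y v w =
     tangential (f (p y)) (pderiv_at \<nu> p y v) \<bullet> pderiv_at f p y w"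

text \<open>The Riemannian measure \<open>\<surd>det g dy\<close>; these conditions determine \<open>\<mu>\<close> uniquely.\<close>

definition induced_measure ::
    "'m::t2_space set \<Rightarrow> ((real ^ 'n) set \<times> (real ^ 'n \<Rightarrow> 'm)) set
      \<Rightarrow> ('m \<Rightarrow> 'a::euclidean_space) \<Rightarrow> 'm measure \<Rightarrow> bool" where
  "induced_measure M A f \<mu> \<longleftrightarrow>
     sets \<mu> = sets (restrict_space borel M) \<and>
     (\<forall>(V, p) \<in> A. \<forall>B \<in> sets borel. B \<subseteq> V \<longrightarrow>
        emeasure \<mu> (p ` B) =
          (\<integral>\<^sup>+ y \<in> B. ennreal (sqrt (det (\<chi> i j. induced_metric f p y (axis i 1) (axis j 1)))) \<partial>lborel))"

text \<open>\<open>lam 1 x \<ge> \<dots> \<ge> lam n x\<close> are the eigenvalues, with multiplicity, of the second fundamental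
  form with respect to the induced metric; \<open>e 1, \<dots>, e n\<close> are principal directions.\<close>

definition principal_curvatures ::
    "'m::t2_space set \<Rightarrow> ((real ^ 'n) set \<times> (real ^ 'n \<Rightarrow> 'm)) set
      \<Rightarrow> ('m \<Rightarrow> 'a::euclidean_space) \<Rightarrow> ('m \<Rightarrow> 'a) \<Rightarrow> (nat \<Rightarrow> 'm \<Rightarrow> real) \<Rightarrow> bool" where
  "principal_curvatures M A f \<nu> lam \<longleftrightarrow>
     (\<forall>x \<in> M. \<forall>i j. 1 \<le> i \<and> i \<le> j \<and> j \<le> CARD('n) \<longrightarrow> lam j x \<le> lam i x) \<and>
     (\<forall>(V, p) \<in> A. \<forall>y \<in> V. \<exists>e :: nat \<Rightarrow> real ^ 'n.
        (\<forall>i \<in> {1..CARD('n)}. \<forall>j \<in> {1..CARD('n)}.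
           induced_metric f p y (e i) (e j) = (if i = j then 1 else 0)) \<and>
        (\<forall>i \<in> {1..CARD('n)}. \<forall>w.
           second_fundamental_form f \<nu> p y (e i) w = lam i (p y) * induced_metric f p y (e i) w))"


definition elem_sym :: "nat \<Rightarrow> nat \<Rightarrow> (nat \<Rightarrow> real) \<Rightarrow> real" where
  "elem_sym n k l = (\<Sum>S | S \<subseteq> {1..n} \<and> card S = k. \<Prod>i\<in>S. l i)"

definition mean_curvature :: "nat \<Rightarrow> (nat \<Rightarrow> 'm \<Rightarrow> real) \<Rightarrow> nat \<Rightarrow> 'm \<Rightarrow> real" where
  "mean_curvature n lam k x = elem_sym n k (\<lambda>i. lam i x) / real (n choose k)"

definition arccot :: "real \<Rightarrow> real" where
  "arccot x = (THE t. 0 < t \<and> t < pi \<and> cot t = x)"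

definition normal_graph ::
    "('m \<Rightarrow> 'a::euclidean_space) \<Rightarrow> ('m \<Rightarrow> 'a) \<Rightarrow> ('m \<Rightarrow> real) \<Rightarrow> 'm \<Rightarrow> 'a" where
  "normal_graph f \<nu> u x = sphere_exp (f x) (u x *\<^sub>R \<nu> x)"

definition focal_map ::
    "('m \<Rightarrow> 'a::euclidean_space) \<Rightarrow> ('m \<Rightarrow> 'a) \<Rightarrow> (nat \<Rightarrow> 'm \<Rightarrow> real) \<Rightarrow> nat \<Rightarrow> 'm \<Rightarrow> 'a" where
  "focal_map f \<nu> lam i x = sphere_exp (f x) (- arccot (lam i x) *\<^sub>R \<nu> x)"

definition focal_height :: "(nat \<Rightarrow> 'm \<Rightarrow> real) \<Rightarrow> nat \<Rightarrow> 'm \<Rightarrow> real" where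
  "focal_height lam i x = - arccot (lam i x)"

lemma focal_map_eq_normal_graph:
  "focal_map f \<nu> lam i = normal_graph f \<nu> (focal_height lam i)"
  by (simp add: fun_eq_iff focal_map_def normal_graph_def focal_height_def)

definition normal_jacobian :: "nat \<Rightarrow> (nat \<Rightarrow> 'm \<Rightarrow> real) \<Rightarrow> 'm \<Rightarrow> real \<Rightarrow> real" where
  "normal_jacobian n lam x t = (\<Prod>j = 1..n. cos t + lam j x * sin t)"

text \<open>The oriented volume of \<open>normal_graph f \<nu> u\<close>. It is a function of the height \<open>u\<close>, since the
  map alone determines the height only modulo \<open>2\<pi>\<close>. The inner integral changes sign when
  \<open>u x < 0\<close>.\<close>

definition oriented_volume ::
    "nat \<Rightarrow> 'a::euclidean_space set \<Rightarrow> 'm measure \<Rightarrow> (nat \<Rightarrow> 'm \<Rightarrow> real) \<Rightarrow> ('m \<Rightarrow> real) \<Rightarrow> real" where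
  "oriented_volume n \<Omega> \<mu> lam u =
     sphere_volume \<Omega> + (LINT x|\<mu>. (LBINT t=0..u x. normal_jacobian n lam x t))"

text \<open>The oriented volume of \<open>focal_map f \<nu> lam i\<close>.\<close>

definition focal_volume ::
    "nat \<Rightarrow> 'a::euclidean_space set \<Rightarrow> 'm measure \<Rightarrow> (nat \<Rightarrow> 'm \<Rightarrow> real) \<Rightarrow> nat \<Rightarrow> real" where
  "focal_volume n \<Omega> \<mu> lam i = oriented_volume n \<Omega> \<mu> lam (focal_height lam i)"

end

theory Submission
  imports Defs
begin

text \<open>
  The sphere volume of the enclosed domain cancels, so \<open>V[b\<^sub>n] - V[b\<^sub>1]\<close> is the integral over \<open>M\<close> of
  \<open>J\<close> between two focal heights. Pointwise this is at most \<open>(\<lambda>\<^sub>1 - \<lambda>\<^sub>n)\<^bsup>n+1\<^esup> / (n(n+1))\<close>. On the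
  other side,
  \<open>n(n-1)(E\<^sub>1\<^sup>2 - E\<^sub>2) = \<Sum>(\<lambda>\<^sub>j - E\<^sub>1)\<^sup>2 \<ge> (\<lambda>\<^sub>1 - \<lambda>\<^sub>n)\<^sup>2 / 2\<close>. Since a non-integrable function has
  integral 0, the integrals can be compared only after both sides are known to be integrable: the
  ordered principal curvatures are continuous, hence bounded and measurable, and \<open>\<mu>\<close> is finite.
\<close>

section \<open>Convex combinations and variance\<close>

text \<open>A closed form makes \<open>arccot\<close> visibly measurable and bounded by
  \<open>pi\<close>, and gives \<open>- arccot x = arctan x - pi / 2\<close>, the shift used for the
  focal heights.\<close>

lemma arccot_eq: "arccot x = arctan (- x) + pi / 2"
  unfolding arccot_def
proof (rule the_equality)
  have "cot (arctan (- x) + pi / 2) = x"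
    by (simp add: cot_def sin_add cos_add cos_arctan sin_arctan add_nonneg_eq_0_iff)
  then show "0 < arctan (- x) + pi / 2 \<and> arctan (- x) + pi / 2 < pi \<and> cot (arctan (- x) + pi / 2) = x"
    using arctan_bounded[of "- x"] by auto
next
  fix t assume t: "0 < t \<and> t < pi \<and> cot t = x"
  then have "arctan (- x) = t - pi / 2"
    by (intro arctan_unique) (auto simp: tan_def cot_def sin_diff cos_diff)
  then show "t = arctan (- x) + pi / 2" by simp
qed

text \<open>Young's inequality with weights \<open>m\<close> and 1. The induction multiplies the
  previous case by \<open>b\<close> and adds the nonnegative term
  \<open>(m + 1) * a ^ m * (a - b)^2\<close>, which supplies exactly the missing powers.\<close>

lemma weighted_power_mean_le:
  fixes a b :: real
  assumes "a \<ge> 0" "b \<ge> 0"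
  shows "a ^ m * b \<le> (real m * a ^ Suc m + b ^ Suc m) / real (Suc m)"
proof -
  have "real (Suc m) * (a ^ m * b) \<le> real m * a ^ Suc m + b ^ Suc m"
  proof (induction m)
    case 0
    then show ?case by simp
  next
    case (Suc m)
    have "0 \<le> real (Suc m) * a ^ m * (a - b)\<^sup>2"
      using assms by simp
    moreover have "b * (real (Suc m) * (a ^ m * b)) \<le> b * (real m * a ^ Suc m + b ^ Suc m)"
      using Suc assms by (intro mult_left_mono) auto
    ultimately show ?case
      by (simp add: algebra_simps power2_eq_square)
  qed
  then show ?thesis by (simp add: field_simps)
qed

text \<open>One weight \<open>\<alpha>\<close> serves all \<open>a\<close> and \<open>b\<close>;
  this uniformity later lets the bound be integrated while \<open>a\<close> and \<open>b\<close>
  vary. The recursion for the weight simplifies to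
  \<open>(m * \<alpha> + \<sigma>) / (m + 1)\<close>, so the weight obtained is the mean of the
  \<open>\<tau> j\<close>.\<close>

lemma prod_convex_combination_le:
  fixes \<tau> :: "'i \<Rightarrow> real"
  assumes "finite F" and "\<And>j. j \<in> F \<Longrightarrow> 0 \<le> \<tau> j \<and> \<tau> j \<le> 1"
  shows "\<exists>\<alpha>. 0 \<le> \<alpha> \<and> \<alpha> \<le> 1 \<and> (\<forall>a\<ge>0. \<forall>b\<ge>0.
    (\<Prod>j\<in>F. (1 - \<tau> j) * a + \<tau> j * b) \<le> (1 - \<alpha>) * a ^ card F + \<alpha> * b ^ card F)"
  using assms
proof (induction F rule: finite_induct)
  case empty
  show ?case by (intro exI[of _ 0]) auto
next
  case (insert k F)
  then obtain \<alpha> where \<alpha>: "0 \<le> \<alpha>" "\<alpha> \<le> 1" and le: "\<And>a b. a \<ge> 0 \<Longrightarrow> b \<ge> 0 \<Longrightarrow>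
    (\<Prod>j\<in>F. (1 - \<tau> j) * a + \<tau> j * b) \<le> (1 - \<alpha>) * a ^ card F + \<alpha> * b ^ card F"
    by blast
  define m where "m = card F"
  define \<sigma> where "\<sigma> = \<tau> k"
  have \<sigma>: "0 \<le> \<sigma>" "\<sigma> \<le> 1" using insert.prems[of k] by (auto simp: \<sigma>_def)
  \<comment> \<open>Young's inequality splits the mixed terms \<open>a\<^sup>m b\<close> and \<open>b\<^sup>m a\<close> between the pure powers.\<close>
  define \<beta> where "\<beta> = \<alpha> * \<sigma> + ((1 - \<alpha>) * \<sigma> + \<alpha> * (1 - \<sigma>) * real m) / real (Suc m)"
  \<comment> \<open>The subtracted expression is the coefficient of \<open>a ^ Suc m\<close> after
    the splitting. As it is nonnegative, \<open>\<beta>\<close> is at most 1.\<close>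
  have "\<beta> = 1 - ((1 - \<alpha>) * (1 - \<sigma>) + ((1 - \<alpha>) * \<sigma> * real m + \<alpha> * (1 - \<sigma>)) / real (Suc m))"
    by (simp add: \<beta>_def field_simps)
  moreover have "0 \<le> \<beta>" 
    using \<alpha> \<sigma> by (auto simp: \<beta>_def intro!: add_nonneg_nonneg divide_nonneg_nonneg mult_nonneg_nonneg)
  moreover have "0 \<le> (1 - \<alpha>) * (1 - \<sigma>) + ((1 - \<alpha>) * \<sigma> * real m + \<alpha> * (1 - \<sigma>)) / real (Suc m)"
    using \<alpha> \<sigma> by (auto intro!: add_nonneg_nonneg divide_nonneg_nonneg mult_nonneg_nonneg)
  moreover have "(\<Prod>j\<in>insert k F. (1 - \<tau> j) * a + \<tau> j * b)
      \<le> (1 - \<beta>) * a ^ card (insert k F) + \<beta> * b ^ card (insert k F)" if ab: "a \<ge> 0" "b \<ge> 0" for a b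
  proof -
    have "(\<Prod>j\<in>insert k F. (1 - \<tau> j) * a + \<tau> j * b)
        = ((1 - \<sigma>) * a + \<sigma> * b) * (\<Prod>j\<in>F. (1 - \<tau> j) * a + \<tau> j * b)"
      using insert by (simp add: \<sigma>_def)
    also have "\<dots> \<le> ((1 - \<sigma>) * a + \<sigma> * b) * ((1 - \<alpha>) * a ^ m + \<alpha> * b ^ m)"
      unfolding m_def using \<sigma> ab by (intro mult_left_mono le) auto
    also have "\<dots> = (1 - \<sigma>) * (1 - \<alpha>) * a ^ Suc m + \<sigma> * \<alpha> * b ^ Suc m
        + (1 - \<alpha>) * \<sigma> * (a ^ m * b) + \<alpha> * (1 - \<sigma>) * (b ^ m * a)"
      by (simp add: algebra_simps)
    also have "\<dots> \<le> (1 - \<sigma>) * (1 - \<alpha>) * a ^ Suc m + \<sigma> * \<alpha> * b ^ Suc m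
        + (1 - \<alpha>) * \<sigma> * ((real m * a ^ Suc m + b ^ Suc m) / real (Suc m))
        + \<alpha> * (1 - \<sigma>) * ((real m * b ^ Suc m + a ^ Suc m) / real (Suc m))"
      using \<alpha> \<sigma> ab by (intro add_mono mult_left_mono weighted_power_mean_le order_refl) auto
    also have "\<dots> = (1 - \<beta>) * a ^ Suc m + \<beta> * b ^ Suc m"
      by (simp add: \<beta>_def divide_simps) (simp add: algebra_simps)
    finally show ?thesis using insert by (simp add: m_def)
  qed
  ultimately show ?case by (intro exI[of _ \<beta>]) auto
qed

section \<open>Pair sums, variance and the first two mean curvatures\<close>

text \<open>Adding \<open>k\<close> to the index set creates only the new pairs
  \<open>{k, i}\<close>, which contribute the cross terms of the square. The subset form matches
  \<open>elem_sym\<close> at degree 2.\<close>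

lemma sum_squared_eq_pairs:
  fixes l :: "'i \<Rightarrow> real"
  assumes "finite F"
  shows "(\<Sum>i\<in>F. l i)\<^sup>2 = (\<Sum>i\<in>F. (l i)\<^sup>2) + 2 * (\<Sum>S | S \<subseteq> F \<and> card S = 2. \<Prod>i\<in>S. l i)"
  using assms
proof (induction F rule: finite_induct)
  case empty
  have "{S. S \<subseteq> ({}::'i set) \<and> card S = 2} = {}" by auto
  then show ?case by simp
next
  case (insert k F)
  have eq: "{S. S \<subseteq> insert k F \<and> card S = 2} = {S. S \<subseteq> F \<and> card S = 2} \<union> (\<lambda>i. {k, i}) ` F"
    (is "?L = ?A \<union> ?B")
  proof
    show "?L \<subseteq> ?A \<union> ?B"
      by (auto simp: card_2_iff)
    show "?A \<union> ?B \<subseteq> ?L" using insert by (auto simp: card_2_iff)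
  qed
  have "inj_on (\<lambda>i. {k, i}) F" using insert by (auto simp: inj_on_def doubleton_eq_iff)
  then have "(\<Sum>S\<in>?B. \<Prod>i\<in>S. l i) = (\<Sum>j\<in>F. \<Prod>i\<in>{k, j}. l i)"
    by (simp add: sum.reindex)
  also have "\<dots> = (\<Sum>j\<in>F. l k * l j)"
  proof (rule sum.cong)
    fix j assume "j \<in> F"
    then have "k \<noteq> j" using insert by auto
    then show "(\<Prod>i\<in>{k, j}. l i) = l k * l j" by simp
  qed simp
  finally have B: "(\<Sum>S\<in>?B. \<Prod>i\<in>S. l i) = l k * (\<Sum>j\<in>F. l j)" by (simp add: sum_distrib_left)
  have "(\<Sum>S\<in>?L. \<Prod>i\<in>S. l i) = (\<Sum>S\<in>?A. \<Prod>i\<in>S. l i) + (\<Sum>S\<in>?B. \<Prod>i\<in>S. l i)"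
    unfolding eq using insert by (intro sum.union_disjoint) auto
  then show ?case
    using insert B by (simp add: power2_sum algebra_simps)
qed

text \<open>Only the two terms at \<open>p\<close> and \<open>q\<close> are kept. Their sum is
  smallest when \<open>c\<close> is the midpoint, which is the origin of the factor 2 in the
  constant \<open>2 * n * (n - 1)\<close>.\<close>

lemma variance_ge_range:
  fixes l :: "'i \<Rightarrow> real"
  assumes "finite F" "p \<in> F" "q \<in> F" "p \<noteq> q"
  shows "(l p - l q)\<^sup>2 \<le> 2 * (\<Sum>i\<in>F. (l i - c)\<^sup>2)"
proof -
  have "(l p - l q)\<^sup>2 \<le> 2 * ((l p - c)\<^sup>2 + (l q - c)\<^sup>2)"
    using zero_le_power2[of "l p + l q - 2 * c"] by (simp add: power2_eq_square algebra_simps)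
  also have "(l p - c)\<^sup>2 + (l q - c)\<^sup>2 = (\<Sum>i\<in>{p, q}. (l i - c)\<^sup>2)" using assms by simp
  also have "\<dots> \<le> (\<Sum>i\<in>F. (l i - c)\<^sup>2)" using assms by (intro sum_mono2) auto
  finally show ?thesis by simp
qed

text \<open>Twice the pair sum is \<open>s^2 - q\<close>, and the binomials \<open>n\<close> and
  \<open>n * (n - 1) / 2\<close> normalise it to a variance. In particular the base of the
  \<open>powr\<close> in the final integrand is nonnegative.\<close>

lemma mean_curvature_1_2:
  fixes lam :: "nat \<Rightarrow> 'm \<Rightarrow> real"
  assumes "n \<ge> 2"
  shows "(mean_curvature n lam 1 x)\<^sup>2 - mean_curvature n lam 2 x
     = (\<Sum>i=1..n. (lam i x - mean_curvature n lam 1 x)\<^sup>2) / (real n * (real n - 1))"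
proof -
  define E where "E = mean_curvature n lam 1 x"
  define s where "s = (\<Sum>i=1..n. lam i x)"
  define q where "q = (\<Sum>i=1..n. (lam i x)\<^sup>2)"
  have set1: "{S. S \<subseteq> {1..n} \<and> card S = 1} = (\<lambda>i. {i}) ` {1..n}"
    by (auto simp: card_1_singleton_iff)
  have "elem_sym n 1 (\<lambda>i. lam i x) = s"
    unfolding elem_sym_def set1 s_def by (subst sum.reindex) auto
  then have E: "E = s / n" by (simp add: E_def mean_curvature_def)
  have "elem_sym n 2 (\<lambda>i. lam i x) = (s\<^sup>2 - q) / 2"
    using sum_squared_eq_pairs[of "{1..n}" "\<lambda>i. lam i x"]
    by (simp add: elem_sym_def s_def q_def)
  moreover have "real (n choose 2) = real n * (real n - 1) / 2"
    using assms by (simp add: choose_two real_of_nat_div of_nat_diff)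
  moreover have "(a / 2) / (b / 2) = a / b" for a b :: real by simp
  ultimately have E2: "mean_curvature n lam 2 x = (s\<^sup>2 - q) / (real n * (real n - 1))"
    by (simp only: mean_curvature_def)
  have "(\<Sum>i=1..n. (lam i x - E)\<^sup>2) = q - 2 * E * s + n * (E)\<^sup>2"
    by (simp add: power2_diff sum.distrib sum_subtractf q_def s_def sum_distrib_left sum_distrib_right mult_ac)
  also have "\<dots> = q - s\<^sup>2 / n"
    using assms by (simp add: E power2_eq_square field_simps)
  finally show ?thesis using assms unfolding E_def[symmetric] E2 E
    by (simp add: divide_simps power2_eq_square) (simp add: algebra_simps)
qed

section \<open>The pointwise inequality\<close>

text \<open>A single \<open>F\<close> covers all endpoints in either order, so signed integrals with
  negative upper limit need no case distinction.\<close>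

lemma LBINT_eq_antiderivative:
  fixes f :: "real \<Rightarrow> real"
  assumes "continuous_on UNIV f"
  obtains F where "\<And>x. (F has_real_derivative f x) (at x)"
    and "\<And>a b :: real. (LBINT t=a..b. f t) = F b - F a"
proof -
  have "isCont f x" for x using assms by (simp add: continuous_on_eq_continuous_at)
  then have "\<exists>F. \<forall>x :: real. -\<infinity> < ereal x \<longrightarrow> ereal x < \<infinity> \<longrightarrow> (F has_vector_derivative f x) (at x)"
    by (intro einterval_antiderivative) simp
  then obtain F where F: "\<And>x. (F has_vector_derivative f x) (at x)" by auto
  have "(LBINT t=a..b. f t) = F b - F a" for a b :: real
    by (rule interval_integral_FTC_finite[OF continuous_on_subset[OF assms subset_UNIV]
          has_vector_derivative_at_within[OF F]])
  moreover have "(F has_real_derivative f x) (at x)" for x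
    using F by (simp add: has_real_derivative_iff_has_vector_derivative)
  ultimately show ?thesis by (rule that[rotated])
qed

text \<open>With \<open>t = w - \<pi>/2\<close> the factor \<open>cos t + \<lambda> sin t\<close> is \<open>cos w (tan w - \<lambda>)\<close>, and the focal
  heights become \<open>w = arctan \<lambda>\<close>. In the variable \<open>y = tan w\<close> the integral is that of
  \<open>\<Prod>(y - \<lambda>\<^sub>j) (1 + y\<^sup>2)\<^bsup>-(n+2)/2\<^esup>\<close> over \<open>[\<lambda>\<^sub>n, \<lambda>\<^sub>1]\<close>. The product over the middle curvatures is at
  most a convex combination of its values when they all sit at \<open>\<lambda>\<^sub>n\<close> or all at \<open>\<lambda>\<^sub>1\<close>.\<close>

lemma focal_integral_bound:
  fixes l :: "nat \<Rightarrow> real"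
  assumes "n \<ge> 2" and anti: "\<And>i j. 1 \<le> i \<Longrightarrow> i \<le> j \<Longrightarrow> j \<le> n \<Longrightarrow> l j \<le> l i"
  defines "G \<equiv> \<lambda>u :: real. (LBINT t=0..u. (\<Prod>j=1..n. cos t + l j * sin t))"
  shows "real n * (real n + 1) * \<bar>G (- arccot (l n)) - G (- arccot (l 1))\<bar> \<le> (l 1 - l n) ^ (n + 1)"
proof (cases "l 1 = l n")
  case True
  then show ?thesis by simp
next
  case False
  define d where "d = l 1 - l n"
  have d: "d > 0" using False anti[of 1 n] assms(1) by (simp add: d_def)
  \<comment> \<open>\<open>m\<close> counts the curvatures strictly between the first and last
    index; it is 0 when \<open>n = 2\<close>.\<close>
  obtain m where m: "n = m + 2" using assms(1) by (metis add.commute le_Suc_ex)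
  define J where "J = (\<lambda>t. \<Prod>j=1..n. cos t + l j * sin t)"
  have "continuous_on UNIV J" unfolding J_def by (intro continuous_intros)
  then obtain F where F: "\<And>t. (F has_real_derivative J t) (at t)"
    and FG: "\<And>a b :: real. (LBINT t=a..b. J t) = F b - F a"
    using LBINT_eq_antiderivative by blast
  have G: "G u = F u - F 0" for u
    using FG[of 0 u] by (simp add: G_def J_def zero_ereal_def)
  \<comment> \<open>\<open>\<tau> j\<close> is the relative position of \<open>l j\<close> in the
    interval from \<open>l n\<close> to \<open>l 1\<close>.\<close>
  define \<tau> where "\<tau> j = (l j - l n) / d" for j
  have \<tau>: "0 \<le> \<tau> j \<and> \<tau> j \<le> 1" if "j \<in> {2..n - 1}" for j
    using anti[of j n] anti[of 1 j] that d by (auto simp: \<tau>_def d_def)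
  have l\<tau>: "l j = l n + \<tau> j * d" for j using d by (simp add: \<tau>_def)
  have "card {2..n - 1} = m" by (simp add: m)
  with prod_convex_combination_le[of "{2..n - 1}" \<tau>] \<tau> obtain \<alpha> where \<alpha>: "0 \<le> \<alpha>" "\<alpha> \<le> 1"
    and le: "\<And>a b. a \<ge> 0 \<Longrightarrow> b \<ge> 0 \<Longrightarrow>
      (\<Prod>j=2..n - 1. (1 - \<tau> j) * a + \<tau> j * b) \<le> (1 - \<alpha>) * a ^ m + \<alpha> * b ^ m"
    by auto
  \<comment> \<open>The two summands are the absolute products obtained when all middle curvatures
    sit at \<open>l n\<close> or at \<open>l 1\<close>.\<close>
  define p where "p y = (1 - \<alpha>) * (y - l n) ^ (m + 1) * (l 1 - y) + \<alpha> * (l 1 - y) ^ (m + 1) * (y - l n)" for y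
  \<comment> \<open>\<open>Q\<close> is the antiderivative of \<open>z ^ (m + 1) * (d - z)\<close>
    vanishing at 0; its value at \<open>d\<close> is the sought bound.\<close>
  define Q where "Q z = d * z ^ (m + 2) / (m + 2) - z ^ (m + 3) / (m + 3)" for z
  have Q: "(Q has_real_derivative z ^ (m + 1) * (d - z)) (at z)" for z
  proof -
    have pow: "((\<lambda>z. z ^ Suc k / Suc k) has_real_derivative z ^ k) (at z)" for k and z :: real
      using DERIV_cdivide[OF DERIV_pow[of "Suc k" z], of "real (Suc k)"] by (simp del: of_nat_Suc)
    have "Q = (\<lambda>z. d * (z ^ Suc (m + 1) / Suc (m + 1)) - z ^ Suc (m + 2) / Suc (m + 2))"
      unfolding Q_def by (simp add: fun_eq_iff numeral_3_eq_3)
    moreover have "((\<lambda>z. d * (z ^ Suc (m + 1) / Suc (m + 1)) - z ^ Suc (m + 2) / Suc (m + 2))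
        has_real_derivative d * z ^ (m + 1) - z ^ (m + 2)) (at z)"
      by (intro DERIV_diff DERIV_cmult pow)
    ultimately show ?thesis by (simp add: algebra_simps)
  qed
  \<comment> \<open>The second summand of \<open>p\<close> is a reflected copy of the first, hence
    the minus sign. Both increase by \<open>Q d\<close> across the interval, so
    \<open>\<alpha>\<close> cancels.\<close>
  define P where "P y = (1 - \<alpha>) * Q (y - l n) - \<alpha> * Q (l 1 - y)" for y
  have P: "(P has_real_derivative p y) (at y)" for y
  proof -
    have "((\<lambda>y. Q (y - l n)) has_real_derivative (y - l n) ^ (m + 1) * (d - (y - l n)) * 1) (at y)"
      by (rule DERIV_chain2[OF Q]) (auto intro!: derivative_eq_intros)
    moreover have "((\<lambda>y. Q (l 1 - y)) has_real_derivative (l 1 - y) ^ (m + 1) * (d - (l 1 - y)) * (- 1)) (at y)"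
      by (rule DERIV_chain2[OF Q]) (auto intro!: derivative_eq_intros)
    ultimately have "(P has_real_derivative (1 - \<alpha>) * ((y - l n) ^ (m + 1) * (d - (y - l n)) * 1)
        - \<alpha> * ((l 1 - y) ^ (m + 1) * (d - (l 1 - y)) * (- 1))) (at y)"
      unfolding P_def by (intro DERIV_diff DERIV_cmult)
    then show ?thesis by (simp add: p_def d_def mult.assoc)
  qed
  have J_eq: "J (w - pi / 2) = cos w ^ n * (\<Prod>j=1..n. tan w - l j)" if "cos w \<noteq> 0" for w
  proof -
    have "J (w - pi / 2) = (\<Prod>j=1..n. cos w * (tan w - l j))"
      unfolding J_def using that
      by (intro prod.cong) (auto simp: cos_diff sin_diff tan_def right_diff_distrib mult.commute)
    then show ?thesis by (simp add: prod.distrib)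
  qed
  define a where "a = arctan (l n)"
  define b where "b = arctan (l 1)"
  have range: "- (pi / 2) < w \<and> w < pi / 2" if "a \<le> w" "w \<le> b" for w
    using that arctan_bounded[of "l n"] arctan_bounded[of "l 1"] by (auto simp: a_def b_def)
  have cos_pos: "cos w > 0" if "a \<le> w" "w \<le> b" for w
    using range[OF that] by (intro cos_gt_zero_pi) auto
  \<comment> \<open>Comparing derivatives in \<open>w\<close> replaces the substitution
    \<open>y = tan w\<close> inside the integral.\<close>
  have "norm (F (b - pi / 2) - F (a - pi / 2)) \<le> P (tan b) - P (tan a)"
  proof (rule differentiable_bound_general[where f = "\<lambda>w. F (w - pi / 2)" and \<phi> = "\<lambda>w. P (tan w)"])
    show "a < b" using d by (simp add: a_def b_def d_def arctan_less_iff)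
    have dF: "((\<lambda>w. F (w - pi / 2)) has_real_derivative J (w - pi / 2)) (at w)" for w
      using DERIV_shift[of F "J (w - pi / 2)" w "- pi / 2"] F by simp
    have dP: "((\<lambda>w. P (tan w)) has_real_derivative p (tan w) * inverse ((cos w)\<^sup>2)) (at w)"
      if "a \<le> w" "w \<le> b" for w
      using cos_pos[OF that] by (intro DERIV_chain2[OF P] DERIV_tan) auto
    show "continuous_on {a..b} (\<lambda>w. F (w - pi / 2))"
      using dF DERIV_isCont by (intro continuous_at_imp_continuous_on) blast
    show "continuous_on {a..b} (\<lambda>w. P (tan w))"
      using dP DERIV_isCont by (intro continuous_at_imp_continuous_on) force
    fix w assume "a < w" "w < b"
    then have w: "a \<le> w" "w \<le> b" by auto
    show "((\<lambda>w. F (w - pi / 2)) has_vector_derivative J (w - pi / 2)) (at w)"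
      using dF by (simp add: has_real_derivative_iff_has_vector_derivative)
    show "((\<lambda>w. P (tan w)) has_vector_derivative p (tan w) * inverse ((cos w)\<^sup>2)) (at w)"
      using dP[OF w] by (simp add: has_real_derivative_iff_has_vector_derivative)
    define y where "y = tan w"
    have "tan a \<le> y" "y \<le> tan b"
      using w range[of a] range[of b] range[of w] \<open>a < b\<close> unfolding y_def
      by (auto intro: tan_mono_le)
    then have y: "l n \<le> y" "y \<le> l 1" by (auto simp: a_def b_def tan_arctan)
    have "\<bar>y - l j\<bar> \<le> (1 - \<tau> j) * (y - l n) + \<tau> j * (l 1 - y)" if "j \<in> {2..n - 1}" for j
    proof -
      have "y - l j = (1 - \<tau> j) * (y - l n) - \<tau> j * (l 1 - y)"
        using l\<tau>[of j] by (simp add: d_def algebra_simps)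
      moreover have "0 \<le> (1 - \<tau> j) * (y - l n)" "0 \<le> \<tau> j * (l 1 - y)"
        using \<tau>[OF that] y by auto
      ultimately show ?thesis by linarith
    qed
    then have "(\<Prod>j=2..n - 1. \<bar>y - l j\<bar>) \<le> (\<Prod>j=2..n - 1. (1 - \<tau> j) * (y - l n) + \<tau> j * (l 1 - y))"
      by (intro prod_mono) auto
    also have "\<dots> \<le> (1 - \<alpha>) * (y - l n) ^ m + \<alpha> * (l 1 - y) ^ m"
      using y by (intro le) auto
    finally have mid: "(\<Prod>j=2..n - 1. \<bar>y - l j\<bar>) \<le> (1 - \<alpha>) * (y - l n) ^ m + \<alpha> * (l 1 - y) ^ m" .
    have "{1..n} = insert 1 (insert n {2..n - 1})" using assms(1) by auto
    then have "(\<Prod>j=1..n. \<bar>y - l j\<bar>) = (l 1 - y) * ((y - l n) * (\<Prod>j=2..n - 1. \<bar>y - l j\<bar>))"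
      using y assms(1) by simp
    also have "\<dots> \<le> (l 1 - y) * ((y - l n) * ((1 - \<alpha>) * (y - l n) ^ m + \<alpha> * (l 1 - y) ^ m))"
      using y mid by (intro mult_left_mono) auto
    also have "\<dots> = p y" by (simp add: p_def algebra_simps)
    finally have le_p: "(\<Prod>j=1..n. \<bar>y - l j\<bar>) \<le> p y" .
    have c: "0 < cos w" using cos_pos[OF w] .
    \<comment> \<open>The chain rule for \<open>P (tan w)\<close> contributes the factor
      \<open>1 / (cos w)^2\<close>. It is at least 1, whereas \<open>cos w ^ n\<close> is at most 1,
      so the trigonometric weight only helps.\<close>
    have "cos w ^ n \<le> 1" using c by (intro power_le_one) auto
    moreover have "1 \<le> inverse ((cos w)\<^sup>2)"
      using c by (intro one_le_inverse) (auto intro: power_le_one)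
    ultimately have cc: "cos w ^ n \<le> inverse ((cos w)\<^sup>2)" by linarith
    have "norm (J (w - pi / 2)) = cos w ^ n * (\<Prod>j=1..n. \<bar>y - l j\<bar>)"
      using c by (subst J_eq) (auto simp: y_def abs_mult abs_prod)
    also have "\<dots> \<le> inverse ((cos w)\<^sup>2) * p y"
      using cc le_p c by (intro mult_mono) (auto intro: prod_nonneg)
    finally show "norm (J (w - pi / 2)) \<le> p (tan w) * inverse ((cos w)\<^sup>2)"
      by (simp add: y_def mult.commute)
  qed
  moreover have "P (tan b) - P (tan a) = d ^ (n + 1) / (real n * (real n + 1))"
  proof -
    have "Q 0 = 0" by (simp add: Q_def)
    moreover have "Q d = d ^ (n + 1) / (real n * (real n + 1))"
    proof -
      have "Q d = d ^ (n + 1) * (1 / real n - 1 / (real n + 1))"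
        by (simp add: Q_def m numeral_3_eq_3 right_diff_distrib add.commute)
      also have "1 / real n - 1 / (real n + 1) = 1 / (real n * (real n + 1))"
        using assms(1) by (simp add: field_simps)
      finally show ?thesis by simp
    qed
    moreover have "P (tan b) - P (tan a) = Q d - Q 0"
      unfolding P_def a_def b_def tan_arctan d_def by (simp add: algebra_simps)
    ultimately show ?thesis by simp
  qed
  moreover have "F (b - pi / 2) - F (a - pi / 2) = G (- arccot (l 1)) - G (- arccot (l n))"
    by (simp add: G arccot_eq arctan_minus a_def b_def)
  ultimately have "\<bar>G (- arccot (l n)) - G (- arccot (l 1))\<bar> \<le> d ^ (n + 1) / (real n * (real n + 1))"
    by (simp add: abs_minus_commute)
  moreover have "0 < real n * (real n + 1)" using assms(1) by simp
  ultimately show ?thesis by (simp only: pos_le_divide_eq d_def mult.commute)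
qed

text \<open>The range \<open>d\<close> links both sides: the focal integrals differ by at most
  \<open>d ^ (n + 1)\<close> over \<open>n * (n + 1)\<close>, while \<open>d^2 \<le> K * v\<close>
  by the variance bound. Raising the latter to the power \<open>(n + 1) / 2\<close> produces the
  constant.\<close>

lemma focal_pointwise_bound:
  fixes lam :: "nat \<Rightarrow> 'm \<Rightarrow> real"
  assumes "n \<ge> 2" and "\<And>i j. 1 \<le> i \<Longrightarrow> i \<le> j \<Longrightarrow> j \<le> n \<Longrightarrow> lam j x \<le> lam i x"
  defines "G \<equiv> \<lambda>i. (LBINT t=0..focal_height lam i x. normal_jacobian n lam x t)"
  shows "real n * (real n + 1) / (2 * real n * (real n - 1)) powr ((real n + 1) / 2) * \<bar>G n - G 1\<bar>
    \<le> ((mean_curvature n lam 1 x)\<^sup>2 - mean_curvature n lam 2 x) powr ((real n + 1) / 2)"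
proof -
  define d where "d = lam 1 x - lam n x"
  define K where "K = 2 * real n * (real n - 1)"
  define v where "v = (mean_curvature n lam 1 x)\<^sup>2 - mean_curvature n lam 2 x"
  have d: "0 \<le> d" using assms(1) assms(2)[of 1 n] by (simp add: d_def)
  have K: "0 < K" using assms(1) by (simp add: K_def)
  have "d\<^sup>2 \<le> 2 * (\<Sum>i=1..n. (lam i x - mean_curvature n lam 1 x)\<^sup>2)"
    unfolding d_def using assms(1) by (intro variance_ge_range) auto
  also have "\<dots> = K * v"
    using assms(1) by (simp add: v_def K_def mean_curvature_1_2[OF assms(1)] del: One_nat_def)
  finally have dK: "d\<^sup>2 \<le> K * v" .
  then have "0 \<le> K * v" using zero_le_power2[of d] by linarith
  then have v: "0 \<le> v" using K by (simp add: zero_le_mult_iff)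
  have "real n * (real n + 1) * \<bar>G n - G 1\<bar> \<le> d ^ (n + 1)"
    unfolding G_def focal_height_def normal_jacobian_def d_def
    by (rule focal_integral_bound) (use assms in auto)
  also have "d ^ (n + 1) = (d\<^sup>2) powr ((real n + 1) / 2)"
  \<comment> \<open>Passing from natural to real exponents requires a positive base; for
    \<open>d = 0\<close> both sides vanish.\<close>
  proof (cases "d = 0")
    case False
    then have "0 < d" using d by simp
    then have "d\<^sup>2 = d powr 2" "d ^ (n + 1) = d powr (real n + 1)"
      using powr_realpow[of d 2] powr_realpow[of d "n + 1"] by (auto simp: add.commute)
    moreover have "2 * ((real n + 1) / 2) = real n + 1" by simp
    ultimately show ?thesis by (simp only: powr_powr)
  qed simp
  also have "\<dots> \<le> (K * v) powr ((real n + 1) / 2)"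
    using dK by (intro powr_mono2) auto
  also have "\<dots> = K powr ((real n + 1) / 2) * v powr ((real n + 1) / 2)"
    using K v by (simp add: powr_mult)
  finally show ?thesis
    using K unfolding v_def[symmetric] K_def[symmetric] by (simp add: divide_simps mult.commute)
qed

section \<open>Continuity of ordered eigenvalues\<close>

text \<open>The generalised eigenvalue problem of \<open>h\<close> relative to \<open>g\<close>,
  stated for arbitrary forms on one vector space, so that frames belonging to different points of a
  chart can be compared.\<close>

definition eigenframe ::
    "nat \<Rightarrow> ('v \<Rightarrow> 'v \<Rightarrow> real) \<Rightarrow> ('v \<Rightarrow> 'v \<Rightarrow> real) \<Rightarrow> (nat \<Rightarrow> real) \<Rightarrow> (nat \<Rightarrow> 'v) \<Rightarrow> bool" where
  "eigenframe n g h l e \<longleftrightarrow>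
     (\<forall>i\<in>{1..n}. \<forall>j\<in>{1..n}. g (e i) (e j) = (if i = j then 1 else 0)) \<and>
     (\<forall>i\<in>{1..n}. \<forall>w. h (e i) w = l i * g (e i) w)"

text \<open>In frame coordinates both forms are diagonal, so Rayleigh quotients become weighted
  means of the \<open>l j\<close>.\<close>

lemma eigenframe_combination:
  fixes e :: "nat \<Rightarrow> 'v::real_vector"
  assumes "bilinear g" "bilinear h" "eigenframe n g h l e" "I \<subseteq> {1..n}"
  defines "v \<equiv> \<lambda>c. \<Sum>j\<in>I. c j *\<^sub>R e j"
  shows "k \<in> I \<Longrightarrow> g (e k) (v c) = c k"
    and "g (v c) (v c) = (\<Sum>j\<in>I. (c j)\<^sup>2)"
    and "h (v c) (v c) = (\<Sum>j\<in>I. l j * (c j)\<^sup>2)"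
proof -
  have fin: "finite I" using assms(4) by (rule finite_subset) simp
  have lin: "linear (g x)" "linear (\<lambda>x. g x y)" "linear (h x)" "linear (\<lambda>x. h x y)" for x y
    using assms(1,2) by (auto simp: bilinear_def)
  have left: "g (v c) w = (\<Sum>j\<in>I. c j * g (e j) w)" "h (v c) w = (\<Sum>j\<in>I. c j * h (e j) w)" for c w
    unfolding v_def
    by (simp_all add: linear_sum[OF lin(2)] linear_sum[OF lin(4)] linear_scale[OF lin(2)] linear_scale[OF lin(4)])
  show coord: "g (e k) (v c) = c k" if "k \<in> I" for k c
  proof -
    have "g (e k) (v c) = (\<Sum>j\<in>I. c j * g (e k) (e j))"
      unfolding v_def by (simp add: linear_sum[OF lin(1)] linear_scale[OF lin(1)])
    also have "\<dots> = (\<Sum>j\<in>I. if k = j then c j else 0)"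
      using assms(3,4) that subsetD[OF assms(4)] by (intro sum.cong) (auto simp: eigenframe_def)
    finally show ?thesis using fin that by simp
  qed
  show "g (v c) (v c) = (\<Sum>j\<in>I. (c j)\<^sup>2)"
    by (simp add: left coord power2_eq_square)
  have "h (e j) (v c) = l j * c j" if "j \<in> I" for j
    using assms(3,4) that coord by (auto simp: eigenframe_def)
  then show "h (v c) (v c) = (\<Sum>j\<in>I. l j * (c j)\<^sup>2)"
    by (simp add: left power2_eq_square mult_ac)
qed

text \<open>Pairing a combination with \<open>e k\<close> under \<open>g\<close> recovers its
  \<open>k\<close>-th coefficient, whence independence. The dimension feeds the Courant-Fischer
  count.\<close>

lemma eigenframe_span:
  fixes e :: "nat \<Rightarrow> 'v::euclidean_space"
  assumes "bilinear g" "bilinear h" "eigenframe n g h l e" "I \<subseteq> {1..n}"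
  shows "dim (span (e ` I)) = card I"
    and "v \<in> span (e ` I) \<Longrightarrow> \<exists>c. v = (\<Sum>j\<in>I. c j *\<^sub>R e j)"
proof -
  have fin: "finite I" using assms(4) by (rule finite_subset) simp
  have inj: "inj_on e I"
  proof (rule inj_onI)
    fix i j assume "i \<in> I" "j \<in> I" "e i = e j"
    then show "i = j"
      using assms(3,4) unfolding eigenframe_def by (metis subsetD zero_neq_one)
  qed
  have "independent (e ` I)"
  proof (rule independent_if_scalars_zero)
    fix c x assume sum0: "(\<Sum>y\<in>e ` I. c y *\<^sub>R y) = 0" and "x \<in> e ` I"
    then obtain k where k: "k \<in> I" "x = e k" by blast
    have "(\<Sum>j\<in>I. c (e j) *\<^sub>R e j) = 0" using sum0 inj by (simp add: sum.reindex)
    then have "c (e k) = g (e k) 0"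
      using eigenframe_combination(1)[OF assms k(1), of "\<lambda>j. c (e j)"] by simp
    then show "c x = 0" using assms(1) k by (simp add: bilinear_rzero)
  qed (use fin in simp)
  then show "dim (span (e ` I)) = card I"
    using inj by (metis dim_span_eq_card_independent card_image)
  show "\<exists>c. v = (\<Sum>j\<in>I. c j *\<^sub>R e j)" if v: "v \<in> span (e ` I)"
  proof -
    obtain u where "v = (\<Sum>y\<in>e ` I. u y *\<^sub>R y)"
      using v unfolding span_finite[OF finite_imageI[OF fin]] by blast
    then show ?thesis using inj by (intro exI[of _ "\<lambda>j. u (e j)"]) (simp add: sum.reindex)
  qed
qed

text \<open>The span of the first \<open>i\<close> vectors of one frame meets the span of the last \<open>n - i + 1\<close> vectors
  of any other one, for dimension reasons (Courant--Fischer).\<close>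

lemma eigenvalue_less:
  fixes e e' :: "nat \<Rightarrow> 'v::euclidean_space"
  assumes "n = DIM('v)" and "1 \<le> i" "i \<le> n"
    and "bilinear g" "bilinear h" "eigenframe n g h l e"
    and "bilinear g'" "bilinear h'" "eigenframe n g' h' l' e'"
    and anti: "\<And>j. 1 \<le> j \<Longrightarrow> j \<le> i \<Longrightarrow> l i \<le> l j"
    and less: "\<And>v. v \<in> span (e' ` {i..n}) \<Longrightarrow> v \<noteq> 0 \<Longrightarrow> h v v < \<beta> * g v v"
  shows "l i < \<beta>"
proof -
  define S where "S = span (e ` {1..i})"
  define T where "T = span (e' ` {i..n})"
  have "dim S = i" "dim T = n + 1 - i"
    using eigenframe_span(1)[OF assms(4-6), of "{1..i}"] eigenframe_span(1)[OF assms(7-9), of "{i..n}"]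
      assms(2,3) by (auto simp: S_def T_def)
  moreover have "dim {x + y |x y. x \<in> S \<and> y \<in> T} + dim (S \<inter> T) = dim S + dim T"
    by (rule dim_sums_Int) (auto simp: S_def T_def)
  moreover have "dim {x + y |x y. x \<in> S \<and> y \<in> T} \<le> n"
    unfolding assms(1) by (rule dim_subset_UNIV)
  ultimately have "dim (S \<inter> T) \<noteq> 0" using assms(2,3) by linarith
  then obtain v where v: "v \<in> S" "v \<in> T" "v \<noteq> 0" by (auto simp: dim_eq_0)
  obtain c where c: "v = (\<Sum>j=1..i. c j *\<^sub>R e j)"
    using eigenframe_span(2)[OF assms(4-6), of "{1..i}" v] v(1) assms(3) by (auto simp: S_def)
  have gh: "g v v = (\<Sum>j=1..i. (c j)\<^sup>2)" "h v v = (\<Sum>j=1..i. l j * (c j)\<^sup>2)"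
    using eigenframe_combination(2,3)[OF assms(4-6), of "{1..i}" c] c assms(3) by auto
  \<comment> \<open>On \<open>S\<close> the quotient of \<open>h\<close> by \<open>g\<close> is at
    least \<open>l i\<close>, on \<open>T\<close> it is below \<open>\<beta>\<close>; the common
    vector \<open>v\<close> forces the comparison.\<close>
  have "l i * g v v \<le> h v v"
    unfolding gh sum_distrib_left using anti by (intro sum_mono mult_right_mono) auto
  also have "\<dots> < \<beta> * g v v" using less v by (simp add: T_def)
  finally have "l i * g v v < \<beta> * g v v" .
  moreover have "0 \<le> g v v" by (simp add: gh sum_nonneg)
  ultimately show ?thesis by (simp add: mult_less_cancel_right)
qed

text \<open>Coordinates of a unit vector have modulus at most 1. Applied to a difference of forms,
  this turns convergence of entries into uniform convergence on the unit sphere.\<close>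

lemma bilinear_diagonal_bound:
  fixes q :: "'v::euclidean_space \<Rightarrow> 'v \<Rightarrow> real"
  assumes "bilinear q" "norm v = 1"
  shows "\<bar>q v v\<bar> \<le> (\<Sum>a\<in>Basis. \<Sum>b\<in>Basis. \<bar>q a b\<bar>)"
proof -
  have lin: "linear (q x)" "linear (\<lambda>x. q x y)" for x y
    using assms(1) by (auto simp: bilinear_def)
  have "q v v = q (\<Sum>a\<in>Basis. (v \<bullet> a) *\<^sub>R a) (\<Sum>b\<in>Basis. (v \<bullet> b) *\<^sub>R b)"
    by (simp add: euclidean_representation)
  also have "\<dots> = (\<Sum>b\<in>Basis. \<Sum>a\<in>Basis. (v \<bullet> a) * (v \<bullet> b) * q a b)"
    by (simp add: linear_sum[OF lin(1)] linear_sum[OF lin(2)] linear_scale[OF lin(1)]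
        linear_scale[OF lin(2)] sum_distrib_left mult_ac)
  also have "\<dots> = (\<Sum>a\<in>Basis. \<Sum>b\<in>Basis. (v \<bullet> a) * (v \<bullet> b) * q a b)"
    by (rule sum.swap)
  finally have "\<bar>q v v\<bar> \<le> (\<Sum>a\<in>Basis. \<Sum>b\<in>Basis. \<bar>(v \<bullet> a) * (v \<bullet> b) * q a b\<bar>)"
    by (simp only:) (intro order_trans[OF sum_abs] sum_mono sum_abs)
  also have "\<dots> \<le> (\<Sum>a\<in>Basis. \<Sum>b\<in>Basis. 1 * 1 * \<bar>q a b\<bar>)"
    using assms(2) Basis_le_norm[of _ v] unfolding abs_mult by (intro sum_mono mult_mono) auto
  finally show ?thesis by simp
qed

text \<open>Eigenvectors may jump as \<open>y\<close> varies, so the span \<open>W\<close> of the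
  last ones at \<open>y0\<close> is frozen. There \<open>\<beta> * g - h\<close> is positive
  definite at \<open>y0\<close>, hence also nearby, and the Courant-Fischer comparison with this
  fixed \<open>W\<close> bounds \<open>l y i\<close>.\<close>

lemma eigenvalue_upper_semicontinuous:
  fixes g h :: "'b::topological_space \<Rightarrow> 'v::euclidean_space \<Rightarrow> 'v \<Rightarrow> real"
  assumes n: "n = DIM('v)" and i: "1 \<le> i" "i \<le> n"
    and bil: "\<And>y. y \<in> V \<Longrightarrow> bilinear (g y)" "\<And>y. y \<in> V \<Longrightarrow> bilinear (h y)"
    and cont: "\<And>v w. continuous_on V (\<lambda>y. g y v w)" "\<And>v w. continuous_on V (\<lambda>y. h y v w)"
    and pos: "\<And>y v. y \<in> V \<Longrightarrow> v \<noteq> 0 \<Longrightarrow> 0 < g y v v"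
    and frame: "\<And>y. y \<in> V \<Longrightarrow> \<exists>e. eigenframe n (g y) (h y) (l y) e"
    and anti: "\<And>y j k. y \<in> V \<Longrightarrow> 1 \<le> j \<Longrightarrow> j \<le> k \<Longrightarrow> k \<le> n \<Longrightarrow> l y k \<le> l y j"
    and y0: "y0 \<in> V" and less: "l y0 i < \<beta>"
  shows "\<forall>\<^sub>F y in at y0 within V. l y i < \<beta>"
proof -
  obtain e where e: "eigenframe n (g y0) (h y0) (l y0) e" using frame[OF y0] by blast
  define q where "q y v w = \<beta> * g y v w - h y v w" for y v w
  have bilq: "bilinear (q y)" if "y \<in> V" for y
    using bil[OF that] unfolding q_def bilinear_def by (auto simp: linear_iff algebra_simps)
  have contq: "continuous_on V (\<lambda>y. q y v w)" for v w
    unfolding q_def by (intro continuous_intros cont)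
  define W where "W = span (e ` {i..n})"
  have q0: "0 < q y0 v v" if v: "v \<in> W" "v \<noteq> 0" for v
  proof -
    obtain c where c: "v = (\<Sum>j=i..n. c j *\<^sub>R e j)"
      using eigenframe_span(2)[OF bil[OF y0] e, of "{i..n}" v] v(1) i by (auto simp: W_def)
    have gh: "g y0 v v = (\<Sum>j=i..n. (c j)\<^sup>2)" "h y0 v v = (\<Sum>j=i..n. l y0 j * (c j)\<^sup>2)"
      using eigenframe_combination(2,3)[OF bil[OF y0] e, of "{i..n}" c] c i by auto
    have "h y0 v v \<le> l y0 i * g y0 v v"
      unfolding gh sum_distrib_left using anti[OF y0] i by (intro sum_mono mult_right_mono) auto
    also have "\<dots> < \<beta> * g y0 v v" using less pos[OF y0 v(2)] by simp
    finally show ?thesis by (simp add: q_def)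
  qed
  define K where "K = W \<inter> sphere 0 1"
  have "compact K" unfolding K_def W_def by (intro closed_Int_compact closed_span compact_sphere)
  have contq0: "continuous_on K (\<lambda>v. q y0 v v)"
    by (intro bounded_bilinear.continuous_on[of "q y0"] continuous_intros)
      (use bilq[OF y0] in \<open>simp add: bilinear_conv_bounded_bilinear\<close>)
  \<comment> \<open>Compactness of the unit sphere of \<open>W\<close> upgrades positivity to a
    uniform gap; for empty \<open>K\<close> any positive number will do.\<close>
  obtain \<delta> where \<delta>: "0 < \<delta>" "\<And>v. v \<in> K \<Longrightarrow> \<delta> \<le> q y0 v v"
  proof (cases "K = {}")
    case True
    then show ?thesis by (intro that[of 1]) auto
  next
    case False
    obtain u where u: "u \<in> K" "\<And>v. v \<in> K \<Longrightarrow> q y0 u u \<le> q y0 v v"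
      using continuous_attains_inf[OF \<open>compact K\<close> False contq0] by blast
    then have "0 < q y0 u u" by (intro q0) (auto simp: K_def)
    with u show ?thesis by (intro that[of "q y0 u u"]) auto
  qed
  \<comment> \<open>\<open>r\<close> is continuous, vanishes at \<open>y0\<close> and dominates the
    change of \<open>q\<close> on unit vectors, so \<open>r y < \<delta>\<close> preserves
    positivity on \<open>K\<close>.\<close>
  define r where "r y = (\<Sum>a\<in>Basis. \<Sum>b\<in>Basis. \<bar>q y a b - q y0 a b\<bar>)" for y
  have "continuous_on V r" unfolding r_def by (intro continuous_intros contq)
  then have "(r \<longlongrightarrow> r y0) (at y0 within V)" using y0 by (auto simp: continuous_on_def)
  moreover have "r y0 < \<delta>" using \<delta> by (simp add: r_def)
  ultimately have "\<forall>\<^sub>F y in at y0 within V. r y < \<delta>" by (rule order_tendstoD)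
  moreover have "\<forall>\<^sub>F y in at y0 within V. y \<in> V" by (simp add: eventually_at_filter)
  ultimately show ?thesis
  proof eventually_elim
    case (elim y)
    obtain e1 where e1: "eigenframe n (g y) (h y) (l y) e1" using frame elim by blast
    have bild: "bilinear (\<lambda>v w. q y v w - q y0 v w)"
      using bilq[OF elim(2)] bilq[OF y0] unfolding bilinear_def by (auto intro!: linear_compose_sub)
    have unit: "0 < q y v v" if "v \<in> K" for v
    proof -
      have "\<bar>q y v v - q y0 v v\<bar> \<le> r y"
        using bilinear_diagonal_bound[OF bild, of v] that by (simp add: r_def K_def)
      then show ?thesis using \<delta>(2)[OF that] elim(1) by linarith
    qed
    have "h y v v < \<beta> * g y v v" if "v \<in> span (e ` {i..n})" "v \<noteq> 0" for v
    proof -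
      define u where "u = (1 / norm v) *\<^sub>R v"
      have "u \<in> K" using that by (auto simp: u_def K_def W_def intro: span_scale)
      then have "0 < q y u u" by (rule unit)
      moreover have "q y v v = (norm v)\<^sup>2 * q y u u"
        using that by (simp add: u_def bilinear_lmul[OF bilq[OF elim(2)]]
            bilinear_rmul[OF bilq[OF elim(2)]] power2_eq_square)
      ultimately have "0 < q y v v" using that by simp
      then show ?thesis by (simp add: q_def)
    qed
    then show ?case
      using anti[OF elim(2)] i
      by (intro eigenvalue_less[OF n i bil[OF elim(2)] e1 bil[OF y0] e]) auto
  qed
qed

lemma eigenvalue_continuous_on:
  fixes g h :: "'b::topological_space \<Rightarrow> 'v::euclidean_space \<Rightarrow> 'v \<Rightarrow> real"
  assumes n: "n = DIM('v)" and i: "1 \<le> i" "i \<le> n"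
    and bil: "\<And>y. y \<in> V \<Longrightarrow> bilinear (g y)" "\<And>y. y \<in> V \<Longrightarrow> bilinear (h y)"
    and cont: "\<And>v w. continuous_on V (\<lambda>y. g y v w)" "\<And>v w. continuous_on V (\<lambda>y. h y v w)"
    and pos: "\<And>y v. y \<in> V \<Longrightarrow> v \<noteq> 0 \<Longrightarrow> 0 < g y v v"
    and frame: "\<And>y. y \<in> V \<Longrightarrow> \<exists>e. eigenframe n (g y) (h y) (l y) e"
    and anti: "\<And>y j k. y \<in> V \<Longrightarrow> 1 \<le> j \<Longrightarrow> j \<le> k \<Longrightarrow> k \<le> n \<Longrightarrow> l y k \<le> l y j"
  shows "continuous_on V (\<lambda>y. l y i)"
  unfolding continuous_on_def
proof (intro ballI order_tendstoI)
  fix y0 \<beta> assume "y0 \<in> V"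
  show "\<forall>\<^sub>F y in at y0 within V. l y i < \<beta>" if "l y0 i < \<beta>"
    by (rule eigenvalue_upper_semicontinuous[OF assms \<open>y0 \<in> V\<close> that])
  \<comment> \<open>Replacing \<open>h\<close> by \<open>- h\<close> negates the eigenvalues and reverses their order.\<close>
  have "\<forall>\<^sub>F y in at y0 within V. - l y (n + 1 - (n + 1 - i)) < - \<beta>" if "\<beta> < l y0 i"
  proof (rule eigenvalue_upper_semicontinuous[where g = g and h = "\<lambda>y v w. - h y v w"
        and l = "\<lambda>y k. - l y (n + 1 - k)" and n = n])
    show "\<exists>e. eigenframe n (g y) (\<lambda>v w. - h y v w) (\<lambda>k. - l y (n + 1 - k)) e" if y: "y \<in> V" for y
    proof -
      obtain e where "eigenframe n (g y) (h y) (l y) e" using frame[OF y] by blast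
      then have "eigenframe n (g y) (\<lambda>v w. - h y v w) (\<lambda>k. - l y (n + 1 - k)) (\<lambda>k. e (n + 1 - k))"
        unfolding eigenframe_def by (intro conjI ballI allI) (auto simp: Suc_diff_le)
      then show ?thesis by blast
    qed
    show "bilinear (\<lambda>v w. - h y v w)" if "y \<in> V" for y
      using bil(2)[OF that] unfolding bilinear_def by (auto intro: linear_compose_neg)
    show "- l y (n + 1 - k) \<le> - l y (n + 1 - j)" if "y \<in> V" "1 \<le> j" "j \<le> k" "k \<le> n" for y j k
      using that by (simp add: anti)
  qed (use n i bil(1) cont pos \<open>y0 \<in> V\<close> that in \<open>auto intro: continuous_on_minus\<close>)
  \<comment> \<open>Order reversal is an involution on \<open>{1..n}\<close>:
    \<open>n + 1 - (n + 1 - i)\<close> is \<open>i\<close>.\<close>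
  then show "\<forall>\<^sub>F y in at y0 within V. \<beta> < l y i" if "\<beta> < l y0 i"
    using that i by simp
qed

section \<open>Continuity and integrability on the hypersurface\<close>

text \<open>Unfolds one level of \<open>Ck_on\<close>. Openness of \<open>V\<close> identifies
  differentiability within \<open>V\<close> with the unrestricted kind, which gives linearity of
  \<open>frechet_derivative\<close>.\<close>

lemma smooth_on_frechet_derivative:
  assumes "smooth_on V g" "open V"
  shows "continuous_on V g"
    and "continuous_on V (\<lambda>y. frechet_derivative g (at y) v)"
    and "y \<in> V \<Longrightarrow> linear (frechet_derivative g (at y))"
proof -
  have "Ck_on (Suc 0) V g" using assms(1) unfolding smooth_on_def by blast
  then have diff: "g differentiable_on V"
    and cont: "\<forall>v. continuous_on V (\<lambda>y. frechet_derivative g (at y) v)"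
    unfolding Ck_on.simps by blast+
  show "continuous_on V (\<lambda>y. frechet_derivative g (at y) v)" using cont by (rule spec)
  show "continuous_on V g" using diff by (rule differentiable_imp_continuous_on)
  show "linear (frechet_derivative g (at y))" if "y \<in> V"
  proof (rule linear_frechet_derivative)
    have "g differentiable at y within V" using diff that unfolding differentiable_on_def by blast
    then show "g differentiable at y" by (simp only: at_within_open[OF that assms(2)])
  qed
qed

text \<open>On each chart image \<open>\<phi>\<close> is the composite of
  \<open>\<phi> \<circ> p\<close> with the continuous inverse \<open>c\<close>; the images form an
  open cover, and the pasting lemma glues.\<close>

lemma continuous_on_charts:
  fixes M :: "'m::t2_space set" and A :: "((real ^ 'n) set \<times> (real ^ 'n \<Rightarrow> 'm)) set"
    and \<phi> :: "'m \<Rightarrow> 'b::topological_space"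
  assumes M: "smooth_closed_manifold M A"
    and cont: "\<And>V p. (V, p) \<in> A \<Longrightarrow> continuous_on V (\<lambda>y. \<phi> (p y))"
  shows "continuous_on M \<phi>"
proof -
  define T where "T i = snd i ` fst i" for i :: "(real ^ 'n) set \<times> (real ^ 'n \<Rightarrow> 'm)"
  have ope: "openin (top_of_set M) (T i)" if "i \<in> A" for i
    using M that unfolding smooth_closed_manifold_def T_def split_beta by blast
  have cover: "M = (\<Union>i\<in>A. T i)"
    using M unfolding smooth_closed_manifold_def T_def split_beta by blast
  have "continuous_on (T i) \<phi>" if i_in: "i \<in> A" for i
  proof -
    obtain V p where i: "i = (V, p)" by (cases i)
    obtain c where c: "homeomorphism V (p ` V) p c"
      using M i_in unfolding i smooth_closed_manifold_def by fast
    then have cont_c: "continuous_on (p ` V) c" and im: "c ` p ` V \<subseteq> V"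
      and inv: "\<forall>x\<in>p ` V. p (c x) = x"
      unfolding homeomorphism_def by blast+
    have "continuous_on V (\<lambda>y. \<phi> (p y))" using cont that unfolding i by blast
    from continuous_on_compose2[OF this cont_c im]
    have "continuous_on (p ` V) (\<lambda>x. \<phi> (p (c x)))" .
    then have "continuous_on (p ` V) \<phi>"
      by (rule continuous_on_eq) (simp only: inv)
    then show ?thesis unfolding T_def i by simp
  qed
  then have local: "continuous_map (subtopology (top_of_set M) (T i)) euclidean \<phi>" if "i \<in> A" for i
    using continuous_on_subset[of "T i" \<phi> "M \<inter> T i"] that by (simp add: subtopology_subtopology)
  have "continuous_map (top_of_set M) euclidean \<phi>"
  proof (rule pasting_lemma[of A "top_of_set M" T euclidean "\<lambda>_. \<phi>" \<phi>])
    show "\<exists>j. j \<in> A \<and> x \<in> T j \<and> \<phi> x = \<phi> x" if "x \<in> topspace (top_of_set M)" for x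
      using that cover by auto
  qed (use ope local in auto)
  then show ?thesis by simp
qed

section \<open>Measurability and finiteness of the induced measure\<close>

lemma sets_induced_measure:
  "induced_measure M A f \<mu> \<Longrightarrow> sets \<mu> = sets (restrict_space borel M)"
  by (simp add: induced_measure_def)

lemma space_induced_measure:
  assumes "induced_measure M A f \<mu>"
  shows "space \<mu> = M"
  using sets_eq_imp_space_eq[OF sets_induced_measure[OF assms]] by (simp add: space_restrict_space)

lemma measurable_induced_measure:
  fixes \<phi> :: "'m::t2_space \<Rightarrow> real"
  assumes "induced_measure M A f \<mu>" "continuous_on M \<phi>"
  shows "\<phi> \<in> borel_measurable \<mu>"
  using borel_measurable_continuous_on_restrict[OF assms(2)] sets_induced_measure[OF assms(1)]
  by (simp cong: measurable_cong_sets)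

text \<open>Each point has a relatively open neighbourhood of finite measure, namely the image of a
  small ball on which the continuous density is bounded. Compactness of \<open>M\<close> leaves
  finitely many of them.\<close>

lemma finite_induced_measure:
  fixes M :: "'m::t2_space set" and A :: "((real ^ 'n) set \<times> (real ^ 'n \<Rightarrow> 'm)) set"
    and f :: "'m \<Rightarrow> 'a::euclidean_space"
  assumes M: "smooth_closed_manifold M A" and f: "smooth_map A f"
    and \<mu>: "induced_measure M A f \<mu>"
  shows "finite_measure \<mu>"
proof
  have "\<exists>U. openin (top_of_set M) U \<and> x \<in> U \<and> emeasure \<mu> U < \<infinity>" if "x \<in> M" for x
  proof -
    have "x \<in> (\<Union>(V, p)\<in>A. p ` V)" using that M by (simp add: smooth_closed_manifold_def)
    then obtain V p y where A: "(V, p) \<in> A" and y: "y \<in> V" "x = p y" by auto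
    have V: "open V" and ope: "openin (top_of_set M) (p ` V)"
      using M A unfolding smooth_closed_manifold_def by fast+
    obtain c where c: "homeomorphism V (p ` V) p c"
      using M A unfolding smooth_closed_manifold_def by fast
    have sm: "smooth_on V (f \<circ> p)" using f A by (auto simp: smooth_map_def)
    \<comment> \<open>The closed ball bounds the density by compactness; the open one has an open
      image.\<close>
    obtain r where r: "0 < r" "cball y r \<subseteq> V" using V y open_contains_cball by blast
    define D where "D = (\<lambda>y. sqrt (det (\<chi> i j. induced_metric f p y (axis i 1) (axis j 1))) :: real)"
    have "continuous_on V D"
      unfolding D_def det_def induced_metric_def vec_lambda_beta
      by (intro continuous_intros smooth_on_frechet_derivative(2)[OF sm V])
    then have "compact (D ` cball y r)"
      by (intro compact_continuous_image continuous_on_subset[OF _ r(2)] compact_cball)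
    then obtain K where K: "\<And>z. z \<in> cball y r \<Longrightarrow> norm (D z) \<le> K"
      using compact_imp_bounded bounded_iff by (metis imageI)
    have ball: "ball y r \<subseteq> V" using r(2) ball_subset_cball by (rule order_trans[rotated])
    have "emeasure \<mu> (p ` B) = (\<integral>\<^sup>+ z \<in> B. ennreal (D z) \<partial>lborel)"
      if "B \<in> sets borel" "B \<subseteq> V" for B
      using \<mu> A that unfolding induced_measure_def D_def by blast
    from this[OF _ ball]
    have "emeasure \<mu> (p ` ball y r) = (\<integral>\<^sup>+ z \<in> ball y r. ennreal (D z) \<partial>lborel)"
      by simp
    also have "\<dots> \<le> (\<integral>\<^sup>+ z. ennreal K * indicator (ball y r) z \<partial>lborel)"
    proof (rule nn_integral_mono)
      fix z
      have "D z \<le> K" if "z \<in> ball y r" using K[of z] that by simp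
      then show "ennreal (D z) * indicator (ball y r) z \<le> ennreal K * indicator (ball y r) z"
        by (simp add: indicator_def ennreal_leI)
    qed
    also have "\<dots> = ennreal K * emeasure lborel (ball y r)"
      by (rule nn_integral_cmult_indicator) simp
    also have "\<dots> < \<infinity>"
      using emeasure_bounded_finite[OF bounded_ball, of y r] by (simp add: ennreal_mult_less_top)
    finally have "emeasure \<mu> (p ` ball y r) < \<infinity>" .
    moreover have "openin (top_of_set M) (p ` ball y r)"
    proof (rule openin_trans[OF homeomorphism_imp_open_map[OF c] ope])
      show "openin (top_of_set V) (ball y r)"
        unfolding openin_open_eq[OF V] using ball open_ball by blast
    qed
    moreover have "x \<in> p ` ball y r" using r(1) y by simp
    ultimately show ?thesis by blast
  qed
  then obtain U where U: "\<And>x. x \<in> M \<Longrightarrow> openin (top_of_set M) (U x)"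
    "\<And>x. x \<in> M \<Longrightarrow> x \<in> U x" "\<And>x. x \<in> M \<Longrightarrow> emeasure \<mu> (U x) < \<infinity>" by metis
  have "compact M" using M by (simp add: smooth_closed_manifold_def)
  then have "(\<forall>c\<in>U ` M. openin (top_of_set M) c) \<and> M \<subseteq> \<Union> (U ` M)
      \<longrightarrow> (\<exists>D\<subseteq>U ` M. finite D \<and> M \<subseteq> \<Union> D)"
    unfolding compact_eq_openin_cover by (rule spec)
  moreover have "(\<forall>c\<in>U ` M. openin (top_of_set M) c) \<and> M \<subseteq> \<Union> (U ` M)" using U by blast
  ultimately obtain D where D: "D \<subseteq> U ` M" "finite D" "M \<subseteq> \<Union> D" by blast
  obtain N where N: "N \<subseteq> M" "finite N" "M \<subseteq> \<Union> (U ` N)"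
    using finite_subset_image[OF D(2,1)] D(3) by blast
  have "U x \<in> sets \<mu>" if "x \<in> M" for x
  proof -
    obtain T where T: "open T" "U x = M \<inter> T"
      using U(1)[OF \<open>x \<in> M\<close>] unfolding openin_open by blast
    have "T \<in> sets borel" using T(1) by (rule borel_open)
    then show ?thesis
      unfolding sets_induced_measure[OF \<mu>] sets_restrict_space T(2) by (rule imageI)
  qed
  then have sets: "U ` N \<subseteq> sets \<mu>" using N(1) by blast
  have "emeasure \<mu> (space \<mu>) \<le> emeasure \<mu> (\<Union> (U ` N))"
    unfolding space_induced_measure[OF \<mu>]
    using N(2,3) sets by (intro emeasure_mono sets.finite_UN) blast+
  also have "\<dots> \<le> (\<Sum>x\<in>N. emeasure \<mu> (U x))"
    using N(2) sets by (rule emeasure_subadditive_finite)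
  also have "\<dots> < \<infinity>" using N(1,2) U(3) by (simp add: ennreal_sum_less_top subset_iff)
  finally show "emeasure \<mu> (space \<mu>) \<noteq> \<infinity>" by simp
qed

text \<open>In a chart the curvatures are the ordered eigenvalues of the second fundamental form
  relative to the metric, both with continuous entries. Injectivity of the differential makes the
  metric positive definite.\<close>

lemma continuous_on_principal_curvature:
  fixes M :: "'m::t2_space set" and A :: "((real ^ 'n) set \<times> (real ^ 'n \<Rightarrow> 'm)) set"
    and f \<nu> :: "'m \<Rightarrow> 'a::euclidean_space"
  assumes M: "smooth_closed_manifold M A" and f: "smooth_embedding M A f"
    and \<nu>: "unit_normal_field M A f \<nu>" and lam: "principal_curvatures M A f \<nu> lam"
    and i: "1 \<le> i" "i \<le> CARD('n)"
  shows "continuous_on M (lam i)"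
proof (rule continuous_on_charts[OF M])
  fix V p assume A: "(V, p) \<in> A"
  have V: "open V" and pV: "p ` V \<subseteq> M"
    using M A unfolding smooth_closed_manifold_def by fast+
  have smf: "smooth_on V (f \<circ> p)" and smn: "smooth_on V (\<nu> \<circ> p)"
    using f \<nu> A by (auto simp: smooth_map_def smooth_embedding_def unit_normal_field_def)
  define g where "g = induced_metric f p"
  define h where "h = second_fundamental_form f \<nu> p"
  note df = smooth_on_frechet_derivative[OF smf V]
  note dn = smooth_on_frechet_derivative[OF smn V]
  show "continuous_on V (\<lambda>y. lam i (p y))"
  proof (rule eigenvalue_continuous_on[where g = g and h = h and n = "CARD('n)" and l = "\<lambda>y k. lam k (p y)"])
    show "bilinear (g y)" if "y \<in> V" for y
      unfolding bilinear_def g_def induced_metric_def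
      using df(3)[OF that] by (auto simp: linear_iff inner_add_left inner_add_right)
    show "bilinear (h y)" if "y \<in> V" for y
      unfolding bilinear_def h_def second_fundamental_form_def tangential_def
      using df(3)[OF that] dn(3)[OF that]
      by (auto simp: linear_iff inner_add_left inner_add_right inner_diff_left algebra_simps)
    show "continuous_on V (\<lambda>y. g y v w)" for v w
      unfolding g_def induced_metric_def by (intro continuous_intros df)
    show "continuous_on V (\<lambda>y. h y v w)" for v w
      unfolding h_def second_fundamental_form_def tangential_def
      by (intro continuous_intros df dn df(1)[unfolded o_def])
    show "0 < g y v v" if "y \<in> V" "v \<noteq> 0" for y v
    proof -
      have "inj (pderiv_at f p y)" using f A that by (auto simp: smooth_embedding_def)
      then have "pderiv_at f p y v \<noteq> 0"
        using that linear_injective_0[OF df(3)[OF that(1)]] by blast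
      then show ?thesis by (simp add: g_def induced_metric_def)
    qed
    show "\<exists>e. eigenframe CARD('n) (g y) (h y) (\<lambda>k. lam k (p y)) e" if "y \<in> V" for y
      using lam A that unfolding principal_curvatures_def eigenframe_def g_def h_def by fast
    show "lam k (p y) \<le> lam j (p y)" if "y \<in> V" "1 \<le> j" "j \<le> k" "k \<le> CARD('n)" for y j k
      using lam pV that unfolding principal_curvatures_def by blast
  qed (use i in auto)
qed

section \<open>Measurability and size of the signed focal integrals\<close>

text \<open>The moving endpoint is absorbed into a jointly measurable integrand over the whole line,
  whose partial integral is measurable.\<close>

lemma measurable_focal_integral:
  fixes u :: "'m \<Rightarrow> real"
  assumes [measurable]: "\<And>j. j \<in> {1..n} \<Longrightarrow> lam j \<in> borel_measurable \<mu>" "u \<in> borel_measurable \<mu>"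
  shows "(\<lambda>x. LBINT t=0..u x. normal_jacobian n lam x t) \<in> borel_measurable \<mu>"
proof -
  define I where "I = (\<lambda>a b x. \<integral>t. (if a x < t \<and> t < b x then normal_jacobian n lam x t else 0) \<partial>lborel)"
  \<comment> \<open>For \<open>u x < 0\<close> the signed integral is minus the integral over the
    interval from \<open>u x\<close> to 0.\<close>
  have "(LBINT t=0..u x. normal_jacobian n lam x t)
      = (if 0 \<le> u x then I (\<lambda>_. 0) u x else - I u (\<lambda>_. 0) x)" for x
    by (auto simp: interval_lebesgue_integral_def set_lebesgue_integral_def I_def einterval_def
        zero_ereal_def indicator_def intro!: Bochner_Integration.integral_cong)
  moreover have "(\<lambda>(x, t). normal_jacobian n lam x t) \<in> borel_measurable (\<mu> \<Otimes>\<^sub>M lborel)"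
    unfolding normal_jacobian_def split_beta' by measurable
  then have "(\<lambda>(x, t). if a x < t \<and> t < b x then normal_jacobian n lam x t else 0)
      \<in> borel_measurable (\<mu> \<Otimes>\<^sub>M lborel)"
    if [measurable]: "a \<in> borel_measurable \<mu>" "b \<in> borel_measurable \<mu>" for a b :: "'m \<Rightarrow> real"
    unfolding split_beta' by measurable
  then have [measurable]: "I a b \<in> borel_measurable \<mu>" if "a \<in> borel_measurable \<mu>" "b \<in> borel_measurable \<mu>" for a b
    unfolding I_def using that by (intro lborel.borel_measurable_lebesgue_integral)
  ultimately show ?thesis by simp
qed

text \<open>Each factor of the Jacobian is at most \<open>1 + B\<close> in modulus, and the mean
  value inequality for an antiderivative covers both signs of \<open>u\<close>.\<close>

lemma abs_focal_integral_le:
  fixes u B :: real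
  assumes "\<And>j. j \<in> {1..n} \<Longrightarrow> \<bar>lam j x\<bar> \<le> B"
  shows "\<bar>LBINT t=0..u. normal_jacobian n lam x t\<bar> \<le> (1 + B) ^ n * \<bar>u\<bar>"
proof -
  have "continuous_on UNIV (normal_jacobian n lam x)"
    unfolding normal_jacobian_def by (intro continuous_intros)
  then obtain F where F: "\<And>t. (F has_real_derivative normal_jacobian n lam x t) (at t)"
    and FG: "\<And>a b :: real. (LBINT t=a..b. normal_jacobian n lam x t) = F b - F a"
    using LBINT_eq_antiderivative by blast
  have "\<bar>cos t + lam j x * sin t\<bar> \<le> 1 + B" if "j \<in> {1..n}" for j t
  proof -
    have "\<bar>lam j x * sin t\<bar> \<le> B * 1"
      unfolding abs_mult using assms[OF that] by (intro mult_mono) auto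
    moreover have "\<bar>cos t\<bar> \<le> 1" by simp
    ultimately show ?thesis by linarith
  qed
  then have "(\<Prod>j=1..n. \<bar>cos t + lam j x * sin t\<bar>) \<le> (\<Prod>j=1..n. 1 + B)" for t
    by (intro prod_mono) simp
  then have bound: "norm (normal_jacobian n lam x t) \<le> (1 + B) ^ n" for t
    by (simp add: normal_jacobian_def abs_prod)
  have "norm (F u - F 0) \<le> (1 + B) ^ n * norm (u - 0)"
    by (rule field_differentiable_bound[OF convex_UNIV F bound]) simp_all
  then show ?thesis using FG[of 0 u] by (simp add: zero_ereal_def)
qed

lemma abs_bounded_on_compact:
  fixes \<phi> :: "'b::topological_space \<Rightarrow> real"
  assumes "continuous_on M \<phi>" "compact M"
  shows "\<exists>B. \<forall>x\<in>M. \<bar>\<phi> x\<bar> \<le> B"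
proof -
  have "bounded (\<phi> ` M)"
    using assms by (intro compact_imp_bounded compact_continuous_image)
  then show ?thesis by (auto simp: bounded_iff)
qed

section \<open>Integration of the pointwise inequality over \<open>M\<close>\<close>

theorem theorem39:
  fixes n :: nat
    and M :: "'m::t2_space set"
    and A :: "((real ^ 'n) set \<times> (real ^ 'n \<Rightarrow> 'm)) set"
    and f \<nu> :: "'m \<Rightarrow> 'a::euclidean_space"
    and \<Omega> :: "'a set"
    and \<mu> :: "'m measure"
    and lam :: "nat \<Rightarrow> 'm \<Rightarrow> real"
  assumes "n = CARD('n)" and "n \<ge> 2" and "DIM('a) = n + 2"
    and "smooth_closed_manifold M A"
    and "smooth_embedding M A f" and "f ` M \<subseteq> sphere 0 1"
    and "unit_normal_field M A f \<nu>"
    and "enclosed_domain M f \<nu> \<Omega>"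
    and "induced_measure M A f \<mu>"
    and "principal_curvatures M A f \<nu> lam"
  shows "real n * (real n + 1) / (2 * real n * (real n - 1)) powr ((real n + 1) / 2)
           * \<bar>focal_volume n \<Omega> \<mu> lam n - focal_volume n \<Omega> \<mu> lam 1\<bar>
         \<le> (LINT x|\<mu>. ((mean_curvature n lam 1 x)\<^sup>2 - mean_curvature n lam 2 x)
                          powr ((real n + 1) / 2))"
proof -
  define G where "G = (\<lambda>i x. LBINT t=0..focal_height lam i x. normal_jacobian n lam x t)"
  define R where "R = (\<lambda>x. ((mean_curvature n lam 1 x)\<^sup>2 - mean_curvature n lam 2 x) powr ((real n + 1) / 2))"
  define C where "C = real n * (real n + 1) / (2 * real n * (real n - 1)) powr ((real n + 1) / 2)"
  have "smooth_map A f" using assms by (simp add: smooth_embedding_def)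
  then interpret finite_measure \<mu> using assms by (intro finite_induced_measure)
  have sp: "space \<mu> = M" using assms by (intro space_induced_measure)
  have cont: "continuous_on M (lam j)" if "j \<in> {1..n}" for j
    using assms that by (intro continuous_on_principal_curvature) auto
  have "\<exists>B. \<forall>x\<in>M. \<bar>lam j x\<bar> \<le> B" if "j \<in> {1..n}" for j
    using abs_bounded_on_compact[OF cont[OF that]] assms(4) unfolding smooth_closed_manifold_def by blast
  then obtain b where b: "\<And>j x. j \<in> {1..n} \<Longrightarrow> x \<in> M \<Longrightarrow> \<bar>lam j x\<bar> \<le> b j" by metis
  \<comment> \<open>Summing moduli gives one nonnegative bound valid for all curvatures at
    once.\<close>
  define B where "B = (\<Sum>j=1..n. \<bar>b j\<bar>)"
  have B: "\<bar>lam j x\<bar> \<le> B" if "j \<in> {1..n}" "x \<in> M" for j x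
  proof -
    have "\<bar>b j\<bar> \<le> B" unfolding B_def using that by (intro member_le_sum) auto
    with b[OF that] show ?thesis by linarith
  qed
  have B0: "0 \<le> B" by (simp add: B_def sum_nonneg)
  have meas [measurable]: "lam j \<in> borel_measurable \<mu>" if "j \<in> {1..n}" for j
    using assms cont[OF that] by (intro measurable_induced_measure)
  have int_G: "integrable \<mu> (G i)" if i: "i \<in> {1..n}" for i
  proof (rule integrable_const_bound)
    have "(\<lambda>x. focal_height lam i x) \<in> borel_measurable \<mu>"
      unfolding focal_height_def arccot_eq using meas[OF i] by measurable
    then show "G i \<in> borel_measurable \<mu>"
      unfolding G_def using meas by (intro measurable_focal_integral)
    have "\<bar>G i x\<bar> \<le> (1 + B) ^ n * pi" if "x \<in> M" for x
    proof -
      have "\<bar>G i x\<bar> \<le> (1 + B) ^ n * \<bar>focal_height lam i x\<bar>"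
        unfolding G_def using B that by (intro abs_focal_integral_le) auto
      also have "\<dots> \<le> (1 + B) ^ n * pi"
        using B0 arctan_bounded[of "- lam i x"]
        by (intro mult_left_mono) (auto simp: focal_height_def arccot_eq)
      finally show ?thesis .
    qed
    then show "AE x in \<mu>. norm (G i x) \<le> (1 + B) ^ n * pi" by (auto simp: sp)
  qed
  have "continuous_on M R"
    unfolding R_def
  proof (intro continuous_on_powr')
    show "continuous_on M (\<lambda>x. (mean_curvature n lam 1 x)\<^sup>2 - mean_curvature n lam 2 x)"
      unfolding mean_curvature_def elem_sym_def using assms(2)
      by (intro continuous_intros cont) auto
    \<comment> \<open>The base may vanish, at umbilic points; continuity of \<open>powr\<close>
      there rests on the positive exponent, and nonnegativity on the variance formula.\<close>
    show "\<forall>x\<in>M. 0 \<le> (mean_curvature n lam 1 x)\<^sup>2 - mean_curvature n lam 2 x \<and>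
        ((mean_curvature n lam 1 x)\<^sup>2 - mean_curvature n lam 2 x = 0 \<longrightarrow> 0 < (real n + 1) / 2)"
      unfolding mean_curvature_1_2[OF assms(2)] using assms(2) by (auto intro!: divide_nonneg_nonneg sum_nonneg)
  qed (rule continuous_on_const)
  then have "R \<in> borel_measurable \<mu>" using assms by (intro measurable_induced_measure)
  moreover obtain b' where "\<forall>x\<in>M. \<bar>R x\<bar> \<le> b'"
    using abs_bounded_on_compact[OF \<open>continuous_on M R\<close>] assms(4)
    unfolding smooth_closed_manifold_def by blast
  ultimately have int_R: "integrable \<mu> R"
    by (intro integrable_const_bound[of _ b']) (auto simp: sp)
  have int_1n: "integrable \<mu> (G 1)" "integrable \<mu> (G n)" using int_G assms(2) by auto
  have le: "C * \<bar>G n x - G 1 x\<bar> \<le> R x" if "x \<in> M" for x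
    unfolding C_def G_def R_def
    using assms(1,2,10) that by (intro focal_pointwise_bound) (auto simp: principal_curvatures_def)
  \<comment> \<open>Integrability of both \<open>G 1\<close> and \<open>G n\<close> allows the two
    integrals to be merged into one.\<close>
  have "C * \<bar>focal_volume n \<Omega> \<mu> lam n - focal_volume n \<Omega> \<mu> lam 1\<bar> = C * \<bar>LINT x|\<mu>. G n x - G 1 x\<bar>"
    using int_1n by (simp add: focal_volume_def oriented_volume_def G_def)
  also have "\<dots> \<le> C * (LINT x|\<mu>. \<bar>G n x - G 1 x\<bar>)"
    by (intro mult_left_mono integral_abs_bound) (simp add: C_def)
  also have "\<dots> = (LINT x|\<mu>. C * \<bar>G n x - G 1 x\<bar>)" by simp
  also have "\<dots> \<le> (LINT x|\<mu>. R x)"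
    using int_1n int_R le by (intro integral_mono) (auto simp: sp)
  finally show ?thesis by (simp add: C_def R_def)
qed

end
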